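(* Let $q\in\mathbb{N}$, let $G=([q],E)$ be a tournament graph, and let the data distribution $P\in\mathbf{P}(G,\mathbf{F})$ be generated by some unknown link function $F_0\in\mathbf{F}$ and some merit vector $\boldsymbol{\theta}_0\in\mathbb{R}^q$. Let $\boldsymbol{r}=(r_1,\dots,r_q)'\in\mathsf{R}$. Then: (a) $\boldsymbol{r}\in R(G,\mathbf{F},P)$ if and only if the following three conditions hold: (i) for all $(\ell,k)\in E$, $\ \operatorname{sign}\big(\mathbb{E}_P[Y_{\ell,k}-\tfrac12]\big)=\operatorname{sign}(r_k-r_\ell)$; (ii) for all $(i,k),(j,\ell)\in E$ with $r_i=r_j$, $\ \operatorname{sign}\big(\mathbb{E}_P[Y_{i,k}-Y_{j,\ell}]\big)=\operatorname{sign}(r_k-r_\ell)$; (iii) for all $(i,k),(j,\ell)\in E$ with $r_i>r_j$, $\ r_\ell\ge r_k\ \Longrightarrow\ \mathbb{E}_P[Y_{i,k}]<\mathbb{E}_P[Y_{j,\ell}]$. (b) The ranking is point identified with respect to $G$ and $\mathbf{F}$ if and only if there is a path of length at most two between any two teams in the tournament graph $G$.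
   Context: **Teams, merits, ranking.** $[q]=\{1,\dots,q\}$ is a set of teams. A merit vector is $\boldsymbol{\theta}\in\mathbb{R}^q$ (smaller $\theta_\ell$ means higher merit; ties allowed). The rank of team $\ell$ is $r_\ell(\boldsymbol{\theta})=1+\sum_{i\in[q]}I\{\theta_\ell>\theta_i\}$ and the ranking is $\boldsymbol{r}(\boldsymbol{\theta})=(r_\ell(\boldsymbol{\theta}))_{\ell\in[q]}$. The set of logically possible rankings is $\mathsf{R}=\{\boldsymbol{r}\in\mathbb{N}^q:\ r_\ell=1+\sum_{k\in[q]}I\{r_k<r_\ell\}\ \forall\ell\in[q]\}$. **Sign.** $\operatorname{sign}(x)=I\{x\ge0\}-I\{x\le0\}$ (so $\operatorname{sign}(0)=0$). **Tournament graph.** $G=([q],E)$ is a simple undirected graph; $E$ is the set of unordered pairs of distinct teams that interact. Conditions stated "for all $(\ell,k)\in E$" apply to both orientations of each edge. **Outcomes.** For an interacting pair, $Y_{\ell,k}\in\{0,1\}$ indicates a win of $\ell$ over $k$, with $Y_{k,\ell}=1-Y_{\ell,k}$. Given a link function $F$ and merits $\boldsymbol{\theta}$, $\mathbb{P}_{F,\boldsymbol{\theta}}(Y_{\ell,k}=1)=F(\theta_\ell,\theta_k)$. Outcomes are mutually independent across pairs and repetitions, and identically distributed across repetitions of the same pair, so the distribution $P$ of the observed data is described by the numbers $\mathbb{E}_P[Y_{\ell,k}]=P(Y_{\ell,k}=1)$, $(\ell,k)\in E$. **Family $\mathbf{F}$.** The set of functions $F:\mathbb{R}\times\mathbb{R}\to(0,1)$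 such that (1) $F(x,y)=1-F(y,x)$ for all $(x,y)\in\mathbb{R}^2$; (2) $F$ is strictly decreasing in its first argument (second fixed) and strictly increasing in its second argument (first fixed). **Identification.** For a family $\mathcal{F}$ of link functions: - permissible distributions: $\mathbf{P}(G,\mathcal{F})=\{(\mathbb{P}_{F,\boldsymbol{\theta}}(Y_{\ell,k}=1))_{(\ell,k)\in E}:\boldsymbol{\theta}\in\mathbb{R}^q,\ F\in\mathcal{F}\}$; - observationally equivalent merits: $\Theta(G,\mathcal{F},P)=\{\boldsymbol{\theta}\in\mathbb{R}^q:\exists F\in\mathcal{F},\ \mathbb{P}_{F,\boldsymbol{\theta}}(Y_{\ell,k}=1)=P(Y_{\ell,k}=1)\ \forall(\ell,k)\in E\}$; - identified set: $R(G,\mathcal{F},P)=\{\boldsymbol{r}(\boldsymbol{\theta}):\boldsymbol{\theta}\in\Theta(G,\mathcal{F},P)\}$. The ranking is *point identified* with respect to $G$ and $\mathcal{F}$ if $R(G,\mathcal{F},P)$ is a singleton for every $P\in\mathbf{P}(G,\mathcal{F})$. *)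

theory Defs
  imports "HOL-Probability.Probability" "Graph_Theory.Pair_Digraph"
begin

text \<open>
  Vectors indexed by \<open>{1..q}\<close> are extensional functions on \<open>{1..q}\<close>, so that equality of
  vectors, and hence being a singleton set of rankings, has its usual meaning.
\<close>

definition merit_vectors :: "nat \<Rightarrow> (nat \<Rightarrow> real) set" where
  "merit_vectors q = {1..q} \<rightarrow>\<^sub>E UNIV"

definition ranking :: "nat \<Rightarrow> (nat \<Rightarrow> real) \<Rightarrow> (nat \<Rightarrow> nat)" where
  "ranking q \<theta> = (\<lambda>l\<in>{1..q}. 1 + (\<Sum>i\<in>{1..q}. of_bool (\<theta> l > \<theta> i)))"

definition possible_rankings :: "nat \<Rightarrow> (nat \<Rightarrow> nat) set" where
  "possible_rankings q =
     {r \<in> {1..q} \<rightarrow>\<^sub>E UNIV. \<forall>l\<in>{1..q}. r l = 1 + (\<Sum>k\<in>{1..q}. of_bool (r k < r l))}"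

text \<open>
  The locale \<^locale>\<open>pair_graph\<close> describes finite simple undirected graphs; the unordered edge
  \<open>{l, k}\<close> is represented by the two arcs \<open>(l, k)\<close> and \<open>(k, l)\<close>.
\<close>

definition tournament_graph :: "nat \<Rightarrow> nat pair_pre_digraph \<Rightarrow> bool" where
  "tournament_graph q G \<longleftrightarrow> pair_graph G \<and> pverts G = {1..q}"

definition link_functions :: "(real \<Rightarrow> real \<Rightarrow> real) set" where
  "link_functions =
     {F. (\<forall>x y. F x y \<in> {0<..<1}) \<and>
         (\<forall>x y. F x y = 1 - F y x) \<and>
         (\<forall>y x x'. x < x' \<longrightarrow> F x' y < F x y) \<and>
         (\<forall>x y y'. y < y' \<longrightarrow> F x y < F x y')}"

text \<open>
  An outcome records one match for every edge. Only the coordinates \<open>(l, k)\<close> with \<open>l < k\<close> are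
  used: they state whether \<open>l\<close> beats \<open>k\<close>, and the other orientation is obtained from
  \<open>wins k l = 1 - wins l k\<close>. Repetitions of a match are independent copies and therefore leave the
  description of the distribution unchanged.
\<close>

type_synonym outcome = "nat \<times> nat \<Rightarrow> bool"

definition wins :: "nat \<Rightarrow> nat \<Rightarrow> outcome \<Rightarrow> real" where
  "wins l k \<omega> = (if l < k then of_bool (\<omega> (l, k)) else 1 - of_bool (\<omega> (k, l)))"

definition tournament_law ::
  "nat pair_pre_digraph \<Rightarrow> (real \<Rightarrow> real \<Rightarrow> real) \<Rightarrow> (nat \<Rightarrow> real) \<Rightarrow> outcome pmf" where
  "tournament_law G F \<theta> =
     Pi_pmf {(l, k) \<in> parcs G. l < k} False (\<lambda>(l, k). bernoulli_pmf (F (\<theta> l) (\<theta> k)))"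

text \<open>For link functions in the family, the law has the prescribed win probabilities.\<close>

lemma prob_wins_tournament_law:
  assumes G: "tournament_graph q G" and F: "F \<in> link_functions" and lk: "(l, k) \<in> parcs G"
  shows "measure_pmf.prob (tournament_law G F \<theta>) {\<omega>. wins l k \<omega> = 1} = F (\<theta> l) (\<theta> k)"
proof -
  interpret pair_graph G using G by (simp add: tournament_graph_def)
  define A where "A = {(l, k) \<in> parcs G. l < k}"
  have fin: "finite A"
    unfolding A_def by (rule finite_subset[OF _ pair_finite_arcs]) auto
  have range: "F x y \<in> {0<..<1}" and Fsym: "F x y = 1 - F y x" for x y
    using F unfolding link_functions_def by blast+
  have F01: "0 \<le> F x y" "F x y \<le> 1" for x y
    using range[of x y] by simp_all
  have comp: "map_pmf (\<lambda>\<omega>. \<omega> (a, b)) (tournament_law G F \<theta>) = bernoulli_pmf (F (\<theta> a) (\<theta> b))"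
    if "(a, b) \<in> A" for a b
    unfolding tournament_law_def A_def[symmetric] using that fin
    by (subst Pi_pmf_component) auto
  have val: "measure_pmf.prob (tournament_law G F \<theta>) {\<omega>. \<omega> (a, b) = c} =
      pmf (bernoulli_pmf (F (\<theta> a) (\<theta> b))) c" if "(a, b) \<in> A" for a b c
    using arg_cong[OF comp[OF that], of "\<lambda>p. pmf p c"]
    by (simp add: pmf_map vimage_def)
  have "l \<noteq> k" using pair_no_loops[OF lk] by simp
  then consider "l < k" | "k < l" by linarith
  then show ?thesis
  proof cases
    case 1
    then have "(l, k) \<in> A" using lk by (simp add: A_def)
    from val[OF this, of True] 1 show ?thesis by (simp add: wins_def F01)
  next
    case 2
    have "(k, l) \<in> parcs G" using lk arcs_symmetric by simp
    then have "(k, l) \<in> A" using 2 by (simp add: A_def)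
    from val[OF this, of False] 2
    have "measure_pmf.prob (tournament_law G F \<theta>) {\<omega>. wins l k \<omega> = 1} = 1 - F (\<theta> k) (\<theta> l)"
      by (simp add: wins_def F01)
    then show ?thesis by (simp only: Fsym[of "\<theta> l" "\<theta> k"])
  qed
qed

definition permissible ::
  "nat \<Rightarrow> nat pair_pre_digraph \<Rightarrow> (real \<Rightarrow> real \<Rightarrow> real) set \<Rightarrow> outcome pmf set" where
  "permissible q G \<F> = {tournament_law G F \<theta> | F \<theta>. F \<in> \<F> \<and> \<theta> \<in> merit_vectors q}"

definition equivalent_merits ::
  "nat \<Rightarrow> nat pair_pre_digraph \<Rightarrow> (real \<Rightarrow> real \<Rightarrow> real) set \<Rightarrow> outcome pmf \<Rightarrow> (nat \<Rightarrow> real) set" where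
  "equivalent_merits q G \<F> P =
     {\<theta> \<in> merit_vectors q. \<exists>F\<in>\<F>. \<forall>(l, k) \<in> parcs G.
        measure_pmf.prob (tournament_law G F \<theta>) {\<omega>. wins l k \<omega> = 1} =
        measure_pmf.prob P {\<omega>. wins l k \<omega> = 1}}"

definition identified_set ::
  "nat \<Rightarrow> nat pair_pre_digraph \<Rightarrow> (real \<Rightarrow> real \<Rightarrow> real) set \<Rightarrow> outcome pmf \<Rightarrow> (nat \<Rightarrow> nat) set" where
  "identified_set q G \<F> P = ranking q ` equivalent_merits q G \<F> P"

definition point_identified ::
  "nat \<Rightarrow> nat pair_pre_digraph \<Rightarrow> (real \<Rightarrow> real \<Rightarrow> real) set \<Rightarrow> bool" where
  "point_identified q G \<F> \<longleftrightarrow>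
     (\<forall>P \<in> permissible q G \<F>. is_singleton (identified_set q G \<F> P))"

end

theory Submission
  imports Defs
begin

text \<open>
  Since \<open>wins\<close> is an indicator, the law only matters through \<open>p l k = F\<^sub>0 (\<theta>\<^sub>0 l) (\<theta>\<^sub>0 k)\<close>, and a
  merit vector \<open>\<theta>\<close> explains these numbers iff they are strictly decreasing in \<open>\<theta> l\<close> and strictly
  increasing in \<open>\<theta> k\<close> along the edges. Indeed, a strictly monotone function on finitely many points
  of the plane extends to the plane as a maximum of functions, one through each point, that fall
  off steeply where a coordinate is worse than at that point and are almost flat otherwise. After
  squashing to \<open>(0, 1)\<close>, replacing the extension \<open>h x y\<close> by \<open>(h x y + 1 - h y x) / 2\<close> makes it a
  link function without changing it on the symmetric set of edges.

  Comparing two teams with a third one, or directly, fixes their order. Conversely, if \<open>u\<close> and \<open>v\<close>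
  are neither adjacent nor have a common neighbour, put both at merit \<open>0\<close>, the neighbours of \<open>u\<close>
  at \<open>2\<close> and everyone else at \<open>1\<close>: moving \<open>v\<close> alone to \<open>1/2\<close> preserves the monotonicity.
\<close>

section \<open>Extending strictly monotone data from finitely many points to the plane\<close>

text \<open>As \<open>M\<close> grows, negative arguments are sent to minus infinity and nonnegative
  ones to 0, while strict monotonicity is kept for every \<open>M > 0\<close>.\<close>

definition kink :: "real \<Rightarrow> real \<Rightarrow> real" where
  "kink M u = (if u < 0 then M * u else u / M)"

lemma kink_strict_mono: "kink M u < kink M v" if "M > 0" "u < v"
proof -
  have "M * u < 0" if "u < 0" using that \<open>M > 0\<close> by (simp add: mult_pos_neg)
  moreover have "v / M \<ge> 0" if "v \<ge> 0" using that \<open>M > 0\<close> by simp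
  ultimately have "M * u < v / M" if "u < 0" "v \<ge> 0" using that by (meson less_le_trans)
  then show ?thesis
    using that by (auto simp: kink_def divide_strict_right_mono)
qed

text \<open>A bound free of \<open>M\<close>: it controls one summand while the other is driven to
  minus infinity.\<close>

lemma kink_le_abs: "kink M u \<le> \<bar>u\<bar>" if "M \<ge> 1"
proof (cases "u < 0")
  case True
  then have "M * u \<le> 0" using that by (simp add: mult_nonneg_nonpos)
  then show ?thesis using True by (simp add: kink_def)
next
  case False
  then have "u / M \<le> u" using that by (simp add: divide_le_eq mult_le_cancel_left1)
  then show ?thesis using False by (simp add: kink_def)
qed

lemma eventually_kink_neg_le:
  assumes "s < 0"
  shows "eventually (\<lambda>M. kink M s + kink M t \<le> c) at_top"
  \<comment> \<open>Dividing by the negative \<open>s\<close> reverses the inequality, so the second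
    threshold on \<open>M\<close> amounts to \<open>M * s \<le> c - \<bar>t\<bar>\<close>.\<close>
  using eventually_ge_at_top[of 1] eventually_ge_at_top[of "(c - \<bar>t\<bar>) / s"]
proof eventually_elim
  case (elim M)
  have "M * s \<le> c - \<bar>t\<bar>" using elim(2) assms by (simp add: divide_le_eq)
  then show ?case using kink_le_abs[OF elim(1), of t] assms by (simp add: kink_def)
qed

text \<open>A negative argument dominates the sum for large \<open>M\<close>. Otherwise the sum is
  \<open>(s + t) / M\<close>, which is 0 or tends to 0; hence \<open>c\<close> is constrained only
  when both arguments are nonnegative.\<close>

lemma eventually_kink_sum_le:
  assumes "s \<ge> 0 \<Longrightarrow> t \<ge> 0 \<Longrightarrow> c \<ge> 0 \<and> (s \<noteq> 0 \<or> t \<noteq> 0 \<longrightarrow> c > 0)"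
  shows "eventually (\<lambda>M. kink M s + kink M t \<le> c) at_top"
proof -
  consider "s < 0" | "t < 0" | "s = 0" "t = 0" | "s \<ge> 0" "t \<ge> 0" "s \<noteq> 0 \<or> t \<noteq> 0" by linarith
  then show ?thesis
  proof cases
    case 1
    then show ?thesis by (rule eventually_kink_neg_le)
  next
    case 2
    then show ?thesis using eventually_kink_neg_le[of t s c] by (simp add: add.commute)
  next
    case 3
    then show ?thesis using assms by (simp add: kink_def)
  next
    case 4
    then have c: "c > 0" using assms by simp
    from eventually_gt_at_top[of 0] eventually_ge_at_top[of "(s + t) / c"]
    show ?thesis
    proof eventually_elim
      case (elim M)
      then have "(s + t) / M \<le> c" using c by (simp add: divide_le_eq mult.commute)
      then show ?case using 4 by (simp add: kink_def add_divide_distrib)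
    qed
  qed
qed

text \<open>The points are indexed and may coincide; \<open>mono\<close> applied in both directions
  then forces equal values, so the data are consistent.\<close>

lemma strict_monotone_extension:
  fixes X Y f :: "'i \<Rightarrow> real"
  assumes fin: "finite I"
    and mono: "\<And>i j. i \<in> I \<Longrightarrow> j \<in> I \<Longrightarrow> X j \<le> X i \<Longrightarrow> Y i \<le> Y j \<Longrightarrow>
      f i \<le> f j \<and> (X i \<noteq> X j \<or> Y i \<noteq> Y j \<longrightarrow> f i < f j)"
  obtains h :: "real \<Rightarrow> real \<Rightarrow> real" where
    "\<And>i. i \<in> I \<Longrightarrow> h (X i) (Y i) = f i"
    "\<And>x x' y. x < x' \<Longrightarrow> h x' y < h x y"
    "\<And>x y y'. y < y' \<Longrightarrow> h x y < h x y'"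
proof (cases "I = {}")
  case True
  then show ?thesis using that[of "\<lambda>x y. y - x"] by simp
next
  case False
  \<comment> \<open>Both arguments of \<open>kink\<close> are nonnegative exactly when
    \<open>mono\<close> applies to \<open>i\<close> and \<open>j\<close>. Since there are finitely
    many pairs, one \<open>M\<close> serves them all.\<close>
  have "eventually (\<lambda>M. \<forall>i\<in>I. \<forall>j\<in>I. kink M (X i - X j) + kink M (Y j - Y i) \<le> f j - f i) at_top"
    using fin mono by (intro eventually_ball_finite ballI eventually_kink_sum_le) auto
  with eventually_gt_at_top[of 0]
  have "eventually (\<lambda>M. M > 0 \<and>
      (\<forall>i\<in>I. \<forall>j\<in>I. kink M (X i - X j) + kink M (Y j - Y i) \<le> f j - f i)) at_top"
    by eventually_elim simp
  then obtain M where M: "M > 0"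
    and le: "\<And>i j. i \<in> I \<Longrightarrow> j \<in> I \<Longrightarrow> kink M (X i - X j) + kink M (Y j - Y i) \<le> f j - f i"
    by (auto simp: eventually_at_top_linorder)
  \<comment> \<open>\<open>g i\<close> takes the value \<open>f i\<close> at its own point. By the
    choice of \<open>M\<close> it is at most \<open>f j\<close> at point \<open>j\<close>, so
    \<open>g j\<close> attains the maximum there.\<close>
  define g where "g i x y = f i + kink M (X i - x) + kink M (y - Y i)" for i x y
  define h where "h x y = Max ((\<lambda>i. g i x y) ` I)" for x y
  \<comment> \<open>Strict growth survives a finite maximum: each old value lies below the new value
    of the same function, hence below the new maximum.\<close>
  have less: "h x y < h x' y'" if "\<And>i. i \<in> I \<Longrightarrow> g i x y < g i x' y'" for x y x' y'
  proof -
    have "g i x y < h x' y'" if "i \<in> I" for i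
      using \<open>i \<in> I\<close> fin unfolding h_def
      by (intro less_le_trans[OF \<open>\<And>i. i \<in> I \<Longrightarrow> g i x y < g i x' y'\<close>] Max_ge) auto
    then show ?thesis unfolding h_def[of x y] using fin False by (subst Max_less_iff) auto
  qed
  show ?thesis
  proof (rule that[of h])
    fix j assume j: "j \<in> I"
    show "h (X j) (Y j) = f j" unfolding h_def
    proof (rule Max_eqI)
      show "finite ((\<lambda>i. g i (X j) (Y j)) ` I)" using fin by simp
      show "b \<le> f j" if "b \<in> (\<lambda>i. g i (X j) (Y j)) ` I" for b
        using that le[OF _ j] by (force simp: g_def)
      have "g j (X j) (Y j) = f j" by (simp add: g_def kink_def)
      then show "f j \<in> (\<lambda>i. g i (X j) (Y j)) ` I" using j by force
    qed
  next
    show "h x' y < h x y" if "x < x'" for x x' y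
      using that kink_strict_mono[OF M] by (intro less) (simp add: g_def)
    show "h x y < h x y'" if "y < y'" for x y y'
      using that kink_strict_mono[OF M] by (intro less) (simp add: g_def)
  qed
qed

section \<open>Logistic squashing and symmetrization\<close>

text \<open>The inverse is the logit \<open>ln (p / (1 - p))\<close>. Working on the logit scale
  frees the extension from the range constraint \<open>(0, 1)\<close>.\<close>

definition logistic :: "real \<Rightarrow> real" where
  "logistic x = 1 / (1 + exp (- x))"

lemma logistic_strict_mono: "x < y \<Longrightarrow> logistic x < logistic y"
  by (simp add: logistic_def divide_strict_left_mono add_pos_pos)

lemma logistic_bounds: "0 < logistic x" "logistic x < 1"
  by (simp_all add: logistic_def add_pos_pos)

lemma logistic_logit: "logistic (ln (p / (1 - p))) = p" if "0 < p" "p < 1"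
proof -
  have "exp (- ln (p / (1 - p))) = (1 - p) / p"
    using that by (simp add: exp_minus)
  then have "1 + exp (- ln (p / (1 - p))) = 1 / p" using that by (simp add: field_simps)
  then show ?thesis by (simp add: logistic_def)
qed

lemma logit_strict_mono: "ln (p / (1 - p)) < ln (p' / (1 - p'))"
  if "0 < p" "p < p'" "p' < 1" for p p' :: real
proof -
  have "p / (1 - p) < p' / (1 - p')"
    using that by (intro frac_less2) auto
  then show ?thesis using that by (subst ln_less_cancel_iff) auto
qed

text \<open>The value is the mean of \<open>logistic (h x y)\<close> and
  \<open>1 - logistic (h y x)\<close>. Both lie in \<open>(0, 1)\<close>, both fall in
  \<open>x\<close> and rise in \<open>y\<close>, and swapping the arguments yields the
  complement.\<close>

lemma symmetrization_link_function:
  assumes "\<And>x x' y. x < x' \<Longrightarrow> h x' y < h x y"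
    and "\<And>x y y'. y < y' \<Longrightarrow> h x y < h x y'"
  shows "(\<lambda>x y. (logistic (h x y) + 1 - logistic (h y x)) / 2) \<in> link_functions"
  unfolding link_functions_def
proof (intro CollectI conjI allI impI)
  fix x y :: real
  show "(logistic (h x y) + 1 - logistic (h y x)) / 2 \<in> {0<..<1}"
    using logistic_bounds[of "h x y"] logistic_bounds[of "h y x"] by simp
  show "(logistic (h x y) + 1 - logistic (h y x)) / 2 =
      1 - (logistic (h y x) + 1 - logistic (h x y)) / 2"
    by (simp add: field_simps)
next
  fix y x x' :: real assume "x < x'"
  then show "(logistic (h x' y) + 1 - logistic (h y x')) / 2 <
      (logistic (h x y) + 1 - logistic (h y x)) / 2"
    using assms(1)[of x x' y] assms(2)[of x x' y]
      logistic_strict_mono[of "h x' y" "h x y"] logistic_strict_mono[of "h y x" "h y x'"] by simp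
next
  fix x y y' :: real assume "y < y'"
  then show "(logistic (h x y) + 1 - logistic (h y x)) / 2 <
      (logistic (h x y') + 1 - logistic (h y' x)) / 2"
    using assms(1)[of y y' x] assms(2)[of y y' x]
      logistic_strict_mono[of "h x y" "h x y'"] logistic_strict_mono[of "h y' x" "h y x"] by simp
qed

lemma link_functions_nonempty: "\<exists>F. F \<in> link_functions"
  using symmetrization_link_function[of "\<lambda>x y. y - x"] by auto

section \<open>Monotonicity and signs of link functions\<close>

lemma link_function_antisym: "F \<in> link_functions \<Longrightarrow> F x y = 1 - F y x"
  and link_function_bounds: "F \<in> link_functions \<Longrightarrow> 0 < F x y \<and> F x y < 1"
  and link_function_antimono_left: "F \<in> link_functions \<Longrightarrow> x < x' \<Longrightarrow> F x' y < F x y"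
  and link_function_mono_right: "F \<in> link_functions \<Longrightarrow> y < y' \<Longrightarrow> F x y < F x y'"
  unfolding link_functions_def greaterThanLessThan_iff mem_Collect_eq by blast+

lemma link_function_less:
  assumes "F \<in> link_functions" "x' \<le> x" "y \<le> y'" "x' < x \<or> y < y'"
  shows "F x y < F x' y'"
  using assms link_function_antimono_left[OF assms(1), of x' x y]
    link_function_mono_right[OF assms(1), of y y' x']
  by (cases "x' = x"; cases "y = y'") auto

lemma link_function_le:
  assumes "F \<in> link_functions" "x' \<le> x" "y \<le> y'"
  shows "F x y \<le> F x' y'"
  using link_function_less[OF assms] assms by (cases "x' = x \<and> y = y'") fastforce+

lemma sgn_eqI:
  fixes a b :: real
  assumes "a < 0 \<Longrightarrow> b < 0" "a = 0 \<Longrightarrow> b = 0" "a > 0 \<Longrightarrow> b > 0"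
  shows "sgn b = sgn a"
  using assms by (cases a "0 :: real" rule: linorder_cases) simp_all

lemma sgn_link_function_right:
  assumes "F \<in> link_functions"
  shows "sgn (F x y - F x z) = sgn (y - z)"
  using link_function_mono_right[OF assms] by (intro sgn_eqI) auto

text \<open>This is how a common opponent \<open>z\<close> orders two teams with merits
  \<open>x\<close> and \<open>y\<close>.\<close>

lemma sgn_link_function_left:
  assumes "F \<in> link_functions"
  shows "sgn (F x z - F y z) = sgn (y - x)"
  using link_function_antimono_left[OF assms] by (intro sgn_eqI) auto

text \<open>Antisymmetry gives 1/2 on the diagonal, so comparing with 1/2 means comparing with
  \<open>F x x\<close>.\<close>

lemma sgn_link_function_half:
  assumes "F \<in> link_functions"
  shows "sgn (F x y - 1/2) = sgn (y - x)"
proof -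
  have "F x x = 1/2" using link_function_antisym[OF assms, of x x] by simp
  then show ?thesis using sgn_link_function_right[OF assms, of x y x] by (simp only:)
qed

text \<open>The logits of \<open>p\<close> are extended, squashed back and symmetrized. Because
  \<open>E\<close> is symmetric and \<open>p k i = 1 - p i k\<close>, both halves of the
  symmetrization equal \<open>p i k\<close> on \<open>E\<close>.\<close>

lemma link_function_extension:
  fixes \<theta> :: "'v \<Rightarrow> real"
  assumes "finite E" and sym: "\<And>i k. (i, k) \<in> E \<Longrightarrow> (k, i) \<in> E"
    and bounds: "\<And>i k. (i, k) \<in> E \<Longrightarrow> 0 < p i k \<and> p i k < 1"
    and antisym: "\<And>i k. (i, k) \<in> E \<Longrightarrow> p k i = 1 - p i k"
    and mono: "\<And>i k j l. (i, k) \<in> E \<Longrightarrow> (j, l) \<in> E \<Longrightarrow> \<theta> j \<le> \<theta> i \<Longrightarrow> \<theta> k \<le> \<theta> l \<Longrightarrow>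
      p i k \<le> p j l \<and> (\<theta> i \<noteq> \<theta> j \<or> \<theta> k \<noteq> \<theta> l \<longrightarrow> p i k < p j l)"
  obtains F where "F \<in> link_functions" "\<And>i k. (i, k) \<in> E \<Longrightarrow> F (\<theta> i) (\<theta> k) = p i k"
proof -
  define f where "f = (\<lambda>(i, k). ln (p i k / (1 - p i k)))"
  obtain h where ext: "\<And>e. e \<in> E \<Longrightarrow> h (\<theta> (fst e)) (\<theta> (snd e)) = f e"
    and h: "\<And>x x' y. x < x' \<Longrightarrow> h x' y < h x y" "\<And>x y y'. y < y' \<Longrightarrow> h x y < h x y'"
  proof (rule strict_monotone_extension[where I = E and f = f
        and X = "\<lambda>e. \<theta> (fst e)" and Y = "\<lambda>e. \<theta> (snd e)"])
    show "finite E" by fact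
    fix d e assume "d \<in> E" "e \<in> E" "\<theta> (fst e) \<le> \<theta> (fst d)" "\<theta> (snd d) \<le> \<theta> (snd e)"
    moreover obtain i k j l where [simp]: "d = (i, k)" "e = (j, l)" by force
    ultimately have E: "(i, k) \<in> E" "(j, l) \<in> E"
      and "p i k \<le> p j l \<and> (\<theta> i \<noteq> \<theta> j \<or> \<theta> k \<noteq> \<theta> l \<longrightarrow> p i k < p j l)"
      using mono by auto
    moreover have "f d < f e" if "p i k < p j l"
      using logit_strict_mono[OF _ that] bounds[OF E(1)] bounds[OF E(2)] by (simp add: f_def)
    \<comment> \<open>If the two probabilities agree, the strict part of \<open>mono\<close> makes
      the two points coincide, and the logits agree too.\<close>
    ultimately show "f d \<le> f e \<and> (\<theta> (fst d) \<noteq> \<theta> (fst e) \<or> \<theta> (snd d) \<noteq> \<theta> (snd e) \<longrightarrow> f d < f e)"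
      by (cases "p i k = p j l") (auto simp: f_def)
  qed blast
  have val: "logistic (h (\<theta> i) (\<theta> k)) = p i k" if "(i, k) \<in> E" for i k
    using ext[OF that] logistic_logit bounds[OF that] by (simp add: f_def)
  show ?thesis
  proof (rule that[OF symmetrization_link_function[of h, OF h]])
    fix i k assume ik: "(i, k) \<in> E"
    show "(logistic (h (\<theta> i) (\<theta> k)) + 1 - logistic (h (\<theta> k) (\<theta> i))) / 2 = p i k"
      using val[OF ik] val[OF sym[OF ik]] antisym[OF ik] by simp
  qed
qed

section \<open>Win indicators and rankings\<close>

lemma expectation_wins:
  "measure_pmf.expectation P (wins l k) = measure_pmf.prob P {\<omega>. wins l k \<omega> = 1}"
proof -
  have "wins l k = indicator {\<omega>. wins l k \<omega> = 1}"
    by (auto simp: wins_def indicator_def)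
  then have "measure_pmf.expectation P (wins l k) =
      measure_pmf.expectation P (indicator {\<omega>. wins l k \<omega> = 1})" by simp
  then show ?thesis by simp
qed

lemma integrable_wins: "integrable (measure_pmf P) (wins l k)"
  by (rule measure_pmf.integrable_const_bound[of _ 1]) (auto simp: wins_def)

lemma ranking_less_iff:
  assumes "i \<in> {1..q}" "j \<in> {1..q}"
  shows "ranking q \<theta> i < ranking q \<theta> j \<longleftrightarrow> \<theta> i < \<theta> j"
proof -
  have val: "ranking q \<theta> l = 1 + card {m \<in> {1..q}. \<theta> m < \<theta> l}" if "l \<in> {1..q}" for l
    using that by (simp add: ranking_def of_bool_def sum.If_cases Int_def)
  show ?thesis
  proof (cases "\<theta> i < \<theta> j")
    case True
    \<comment> \<open>The inclusion is proper because \<open>i\<close> belongs to the larger set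
      only.\<close>
    then have "{m \<in> {1..q}. \<theta> m < \<theta> i} \<subset> {m \<in> {1..q}. \<theta> m < \<theta> j}" using assms by force
    then have "card {m \<in> {1..q}. \<theta> m < \<theta> i} < card {m \<in> {1..q}. \<theta> m < \<theta> j}"
      by (intro psubset_card_mono) auto
    then show ?thesis using True assms by (simp add: val)
  next
    case False
    then have "{m \<in> {1..q}. \<theta> m < \<theta> j} \<subseteq> {m \<in> {1..q}. \<theta> m < \<theta> i}" by auto
    then have "card {m \<in> {1..q}. \<theta> m < \<theta> j} \<le> card {m \<in> {1..q}. \<theta> m < \<theta> i}"
      by (intro card_mono) auto
    then show ?thesis using False assms by (simp add: val)
  qed
qed

lemma sgn_ranking:
  assumes "i \<in> {1..q}" "j \<in> {1..q}"
  shows "sgn (real (ranking q \<theta> i) - real (ranking q \<theta> j)) = sgn (\<theta> i - \<theta> j)"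
  using ranking_less_iff[OF assms, of \<theta>] ranking_less_iff[OF assms(2,1), of \<theta>]
  by (auto simp: sgn_if)

lemma ranking_cong:
  assumes "\<And>i j. i \<in> {1..q} \<Longrightarrow> j \<in> {1..q} \<Longrightarrow> \<theta> i < \<theta> j \<longleftrightarrow> \<theta>' i < \<theta>' j"
  shows "ranking q \<theta> = ranking q \<theta>'"
  unfolding ranking_def
proof (rule restrict_ext)
  fix l assume "l \<in> {1..q}"
  then have "(\<Sum>i\<in>{1..q}. of_bool (\<theta> l > \<theta> i)) = (\<Sum>i\<in>{1..q}. of_bool (\<theta>' l > \<theta>' i) :: nat)"
    by (intro sum.cong) (simp_all only: assms)
  then show "1 + (\<Sum>i\<in>{1..q}. of_bool (\<theta> l > \<theta> i)) = 1 + (\<Sum>i\<in>{1..q}. of_bool (\<theta>' l > \<theta>' i) :: nat)"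
    by (simp only:)
qed

text \<open>Provides the canonical merit vector behind a possible ranking, namely its own ranks; the
  equation defining \<open>possible_rankings\<close> is the required fixed-point property.\<close>

lemma ranking_possible_ranking:
  assumes "r \<in> possible_rankings q"
  shows "ranking q (\<lambda>l\<in>{1..q}. real (r l)) = r"
proof
  fix l
  show "ranking q (\<lambda>l\<in>{1..q}. real (r l)) l = r l"
  proof (cases "l \<in> {1..q}")
    case True
    then have "ranking q (\<lambda>l\<in>{1..q}. real (r l)) l = 1 + (\<Sum>k\<in>{1..q}. of_bool (r k < r l))"
      unfolding ranking_def by (auto intro!: sum.cong)
    also have "\<dots> = r l" using assms True unfolding possible_rankings_def by auto
    finally show ?thesis .
  next
    case False
    \<comment> \<open>Outside the team set both functions are \<open>undefined\<close> by
      extensionality.\<close>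
    then show ?thesis using assms
      by (auto simp: ranking_def possible_rankings_def PiE_def extensional_def)
  qed
qed

section \<open>Identified merits and rankings on a fixed graph\<close>

context
  fixes q :: nat and G :: "nat pair_pre_digraph"
  assumes G: "tournament_graph q G"
begin

interpretation pair_graph G using G by (simp add: tournament_graph_def)

lemma tournament_arcs:
  assumes "(l, k) \<in> parcs G"
  shows "(k, l) \<in> parcs G" "l \<noteq> k" "l \<in> {1..q}" "k \<in> {1..q}"
  using assms arcs_symmetric pair_no_loops[OF assms] wellformed'[OF assms] G
  by (simp_all add: tournament_graph_def)

text \<open>Win probabilities along arcs are link values, so equivalence of merits becomes a system
  of equations between two link functions.\<close>

lemma equivalent_merits_iff:
  assumes F0: "F\<^sub>0 \<in> link_functions"
  shows "\<theta> \<in> equivalent_merits q G link_functions (tournament_law G F\<^sub>0 \<theta>\<^sub>0) \<longleftrightarrow>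
    \<theta> \<in> merit_vectors q \<and>
    (\<exists>F\<in>link_functions. \<forall>(l, k) \<in> parcs G. F (\<theta> l) (\<theta> k) = F\<^sub>0 (\<theta>\<^sub>0 l) (\<theta>\<^sub>0 k))"
proof -
  have "(\<forall>(l, k) \<in> parcs G.
      measure_pmf.prob (tournament_law G F \<theta>) {\<omega>. wins l k \<omega> = 1} =
      measure_pmf.prob (tournament_law G F\<^sub>0 \<theta>\<^sub>0) {\<omega>. wins l k \<omega> = 1}) \<longleftrightarrow>
    (\<forall>(l, k) \<in> parcs G. F (\<theta> l) (\<theta> k) = F\<^sub>0 (\<theta>\<^sub>0 l) (\<theta>\<^sub>0 k))" if F: "F \<in> link_functions" for F
    by (intro ball_cong refl)
      (clarsimp simp only: prod.case prob_wins_tournament_law[OF G F] prob_wins_tournament_law[OF G F0])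
  then show ?thesis unfolding equivalent_merits_def by (simp cong: bex_cong)
qed

text \<open>Bounds and antisymmetry of the data are inherited from \<open>F\<^sub>0\<close>; only
  monotonicity along the arcs has to be checked for the new merits.\<close>

lemma equivalent_meritsI:
  assumes F0: "F\<^sub>0 \<in> link_functions" and "\<theta> \<in> merit_vectors q"
    and mono: "\<And>i k j l. (i, k) \<in> parcs G \<Longrightarrow> (j, l) \<in> parcs G \<Longrightarrow> \<theta> j \<le> \<theta> i \<Longrightarrow> \<theta> k \<le> \<theta> l \<Longrightarrow>
      F\<^sub>0 (\<theta>\<^sub>0 i) (\<theta>\<^sub>0 k) \<le> F\<^sub>0 (\<theta>\<^sub>0 j) (\<theta>\<^sub>0 l) \<and>
      (\<theta> i \<noteq> \<theta> j \<or> \<theta> k \<noteq> \<theta> l \<longrightarrow> F\<^sub>0 (\<theta>\<^sub>0 i) (\<theta>\<^sub>0 k) < F\<^sub>0 (\<theta>\<^sub>0 j) (\<theta>\<^sub>0 l))"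
  shows "\<theta> \<in> equivalent_merits q G link_functions (tournament_law G F\<^sub>0 \<theta>\<^sub>0)"
proof -
  obtain F where "F \<in> link_functions"
    "\<And>i k. (i, k) \<in> parcs G \<Longrightarrow> F (\<theta> i) (\<theta> k) = F\<^sub>0 (\<theta>\<^sub>0 i) (\<theta>\<^sub>0 k)"
  proof (rule link_function_extension[of "parcs G" "\<lambda>i k. F\<^sub>0 (\<theta>\<^sub>0 i) (\<theta>\<^sub>0 k)" \<theta>])
    show "F\<^sub>0 (\<theta>\<^sub>0 k) (\<theta>\<^sub>0 i) = 1 - F\<^sub>0 (\<theta>\<^sub>0 i) (\<theta>\<^sub>0 k)" for i k
      by (rule link_function_antisym[OF F0])
    show "finite (parcs G)" by (rule pair_finite_arcs)
    show "0 < F\<^sub>0 (\<theta>\<^sub>0 i) (\<theta>\<^sub>0 k) \<and> F\<^sub>0 (\<theta>\<^sub>0 i) (\<theta>\<^sub>0 k) < 1" for i k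
      by (rule link_function_bounds[OF F0])
    show "(k, i) \<in> parcs G" if "(i, k) \<in> parcs G" for i k
      using that by (rule tournament_arcs(1))
    fix i k j l
    assume "(i, k) \<in> parcs G" "(j, l) \<in> parcs G" "\<theta> j \<le> \<theta> i" "\<theta> k \<le> \<theta> l"
    then show "F\<^sub>0 (\<theta>\<^sub>0 i) (\<theta>\<^sub>0 k) \<le> F\<^sub>0 (\<theta>\<^sub>0 j) (\<theta>\<^sub>0 l) \<and>
        (\<theta> i \<noteq> \<theta> j \<or> \<theta> k \<noteq> \<theta> l \<longrightarrow> F\<^sub>0 (\<theta>\<^sub>0 i) (\<theta>\<^sub>0 k) < F\<^sub>0 (\<theta>\<^sub>0 j) (\<theta>\<^sub>0 l))"
      by (rule mono)
  qed blast
  then show ?thesis using assms(2) by (auto simp: equivalent_merits_iff[OF F0])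
qed

lemma identified_set_iff:
  fixes \<theta>\<^sub>0 :: "nat \<Rightarrow> real"
  assumes F0: "F\<^sub>0 \<in> link_functions" and r: "r \<in> possible_rankings q"
  defines "p l k \<equiv> F\<^sub>0 (\<theta>\<^sub>0 l) (\<theta>\<^sub>0 k)"
  shows "r \<in> identified_set q G link_functions (tournament_law G F\<^sub>0 \<theta>\<^sub>0) \<longleftrightarrow>
      (\<forall>(l, k) \<in> parcs G. sgn (p l k - 1/2) = sgn (real (r k) - real (r l)))
    \<and> (\<forall>(i, k) \<in> parcs G. \<forall>(j, l) \<in> parcs G. r i = r j \<longrightarrow>
         sgn (p i k - p j l) = sgn (real (r k) - real (r l)))
    \<and> (\<forall>(i, k) \<in> parcs G. \<forall>(j, l) \<in> parcs G. r i > r j \<longrightarrow> (r l \<ge> r k \<longrightarrow> p i k < p j l))"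
  (is "_ \<longleftrightarrow> ?i \<and> ?ii \<and> ?iii")
proof
  assume "r \<in> identified_set q G link_functions (tournament_law G F\<^sub>0 \<theta>\<^sub>0)"
  then obtain \<theta> F where r: "r = ranking q \<theta>" and F: "F \<in> link_functions"
    and p: "\<And>l k. (l, k) \<in> parcs G \<Longrightarrow> p l k = F (\<theta> l) (\<theta> k)"
    unfolding identified_set_def p_def by (force simp: equivalent_merits_iff[OF F0])
  have less: "r i < r j \<longleftrightarrow> \<theta> i < \<theta> j" if "i \<in> {1..q}" "j \<in> {1..q}" for i j
    using ranking_less_iff[OF that] by (simp add: r)
  have le: "r i \<le> r j \<longleftrightarrow> \<theta> i \<le> \<theta> j" if "i \<in> {1..q}" "j \<in> {1..q}" for i j
    using less[OF that(2,1)] by linarith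
  have eq: "r i = r j \<longleftrightarrow> \<theta> i = \<theta> j" if "i \<in> {1..q}" "j \<in> {1..q}" for i j
    using less[OF that] less[OF that(2,1)] by force
  have sgn: "sgn (real (r i) - real (r j)) = sgn (\<theta> i - \<theta> j)"
    if "i \<in> {1..q}" "j \<in> {1..q}" for i j
    using sgn_ranking[OF that] by (simp add: r)
  have ?i
    using tournament_arcs(3,4) by (auto simp: p sgn sgn_link_function_half[OF F])
  moreover have ?ii
  proof (clarify)
    fix i k j l assume *: "(i, k) \<in> parcs G" "(j, l) \<in> parcs G" "r i = r j"
    then have "\<theta> i = \<theta> j" using eq tournament_arcs(3) by blast
    then show "sgn (p i k - p j l) = sgn (real (r k) - real (r l))"
      using * tournament_arcs(4) by (simp add: p sgn sgn_link_function_right[OF F])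
  qed
  moreover have ?iii
  proof (clarify)
    fix i k j l assume *: "(i, k) \<in> parcs G" "(j, l) \<in> parcs G" "r i > r j" "r l \<ge> r k"
    then have "\<theta> j < \<theta> i" "\<theta> k \<le> \<theta> l" using less le tournament_arcs(3,4) by blast+
    then show "p i k < p j l" using * by (simp add: p link_function_less[OF F])
  qed
  ultimately show "?i \<and> ?ii \<and> ?iii" by blast
next
  assume conds: "?i \<and> ?ii \<and> ?iii"
  \<comment> \<open>The ranks themselves serve as merits.\<close>
  define \<theta> where "\<theta> = (\<lambda>l\<in>{1..q}. real (r l))"
  have "\<theta> \<in> equivalent_merits q G link_functions (tournament_law G F\<^sub>0 \<theta>\<^sub>0)"
  proof (rule equivalent_meritsI[OF F0])
    show "\<theta> \<in> merit_vectors q" by (simp add: \<theta>_def merit_vectors_def)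
    fix i k j l
    assume *: "(i, k) \<in> parcs G" "(j, l) \<in> parcs G" "\<theta> j \<le> \<theta> i" "\<theta> k \<le> \<theta> l"
    have \<theta>: "\<theta> i = r i" "\<theta> j = r j" "\<theta> k = r k" "\<theta> l = r l"
      using tournament_arcs(3,4)[OF *(1)] tournament_arcs(3,4)[OF *(2)] by (simp_all add: \<theta>_def)
    show "F\<^sub>0 (\<theta>\<^sub>0 i) (\<theta>\<^sub>0 k) \<le> F\<^sub>0 (\<theta>\<^sub>0 j) (\<theta>\<^sub>0 l) \<and>
        (\<theta> i \<noteq> \<theta> j \<or> \<theta> k \<noteq> \<theta> l \<longrightarrow> F\<^sub>0 (\<theta>\<^sub>0 i) (\<theta>\<^sub>0 k) < F\<^sub>0 (\<theta>\<^sub>0 j) (\<theta>\<^sub>0 l))"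
    \<comment> \<open>With equal first ranks the second condition compares the opponents; otherwise
      \<open>r i > r j\<close> and the third condition gives the strict inequality.\<close>
    proof (cases "r i = r j")
      case True
      then have "sgn (p i k - p j l) = sgn (real (r k) - real (r l))"
        using conds *(1,2) by blast
      then show ?thesis using True *(4) unfolding \<theta> p_def by (auto simp: sgn_if split: if_splits)
    next
      case False
      then have "r i > r j" "r k \<le> r l" using *(3,4) unfolding \<theta> by simp_all
      then have "p i k < p j l" using conds *(1,2) by blast
      then show ?thesis by (simp add: p_def)
    qed
  qed
  then have "ranking q \<theta> \<in> identified_set q G link_functions (tournament_law G F\<^sub>0 \<theta>\<^sub>0)"
    unfolding identified_set_def by blast
  then show "r \<in> identified_set q G link_functions (tournament_law G F\<^sub>0 \<theta>\<^sub>0)"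
    using ranking_possible_ranking[OF r] by (simp add: \<theta>_def)
qed

section \<open>Short paths and point identification\<close>

text \<open>Since \<open>u \<noteq> v\<close> rules out the empty path, only one or two arcs remain.
  By symmetry of the arcs, the middle vertex is a common opponent \<open>w\<close>.\<close>

lemma apath_length_le_two_iff:
  assumes "u \<in> {1..q}" "u \<noteq> v"
  shows "(\<exists>p. pre_digraph.apath (with_proj G) u p v \<and> length p \<le> 2) \<longleftrightarrow>
    (u, v) \<in> parcs G \<or> (\<exists>w. (u, w) \<in> parcs G \<and> (v, w) \<in> parcs G)"
    (is "?path \<longleftrightarrow> ?near")
proof
  assume ?path
  then obtain p where p: "set p \<subseteq> parcs G" "cas u p v" "length p \<le> 2"
    by (auto simp: apath_def awalk_def)
  then consider "p = []" | e where "p = [e]" | e f where "p = [e, f]"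
    by (cases p; cases "tl p"; cases "tl (tl p)") auto
  then show ?near
  proof cases
    case 1
    then show ?thesis using p assms by simp
  next
    case 2
    then show ?thesis using p by (cases e) auto
  next
    case 3
    then have "(u, snd e) \<in> parcs G" "(snd e, v) \<in> parcs G" using p by (cases e; cases f; auto)+
    then show ?thesis using tournament_arcs(1) by blast
  qed
next
  assume ?near
  then show ?path
  proof (elim disjE exE conjE)
    assume "(u, v) \<in> parcs G"
    then have "apath u [(u, v)] v"
      using assms G by (auto simp: apath_def awalk_def tournament_graph_def)
    then show ?path by force
  next
    fix w assume uw: "(u, w) \<in> parcs G" and vw: "(v, w) \<in> parcs G"
    then have "apath u [(u, w), (w, v)] v"
      using assms tournament_arcs[OF uw] tournament_arcs[OF vw] G
      by (auto simp: apath_def awalk_def tournament_graph_def)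
    then show ?path by force
  qed
qed

lemma point_identified_iff:
  "point_identified q G link_functions \<longleftrightarrow>
    (\<forall>u\<in>{1..q}. \<forall>v\<in>{1..q}. u \<noteq> v \<longrightarrow>
      (u, v) \<in> parcs G \<or> (\<exists>w. (u, w) \<in> parcs G \<and> (v, w) \<in> parcs G))"
  (is "?id \<longleftrightarrow> ?near")
proof
  assume near: ?near
  show ?id
    unfolding point_identified_def
  proof
    fix P assume "P \<in> permissible q G link_functions"
    then obtain F0 \<theta>0 where P: "P = tournament_law G F0 \<theta>0"
      and F0: "F0 \<in> link_functions" and \<theta>0: "\<theta>0 \<in> merit_vectors q"
      unfolding permissible_def by blast
    have "ranking q \<theta> = ranking q \<theta>0" if \<theta>: "\<theta> \<in> equivalent_merits q G link_functions P" for \<theta>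
    proof (rule ranking_cong)
      obtain F where F: "F \<in> link_functions"
        and eq: "\<And>l k. (l, k) \<in> parcs G \<Longrightarrow> F (\<theta> l) (\<theta> k) = F0 (\<theta>0 l) (\<theta>0 k)"
        using \<theta> unfolding P equivalent_merits_iff[OF F0] by force
      fix i j assume ij: "i \<in> {1..q}" "j \<in> {1..q}"
      consider "i = j" | "(i, j) \<in> parcs G" | w where "(i, w) \<in> parcs G" "(j, w) \<in> parcs G"
        using near ij by blast
      then have "sgn (\<theta> j - \<theta> i) = sgn (\<theta>0 j - \<theta>0 i)"
      proof cases
        case 2
        then show ?thesis
          using eq[OF 2] sgn_link_function_half[OF F, of "\<theta> i" "\<theta> j"]
            sgn_link_function_half[OF F0, of "\<theta>0 i" "\<theta>0 j"] by simp
      next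
        case 3
        then show ?thesis
          using eq[OF 3(1)] eq[OF 3(2)] sgn_link_function_left[OF F, of "\<theta> i" "\<theta> w" "\<theta> j"]
            sgn_link_function_left[OF F0, of "\<theta>0 i" "\<theta>0 w" "\<theta>0 j"] by simp
      qed simp
      then show "\<theta> i < \<theta> j \<longleftrightarrow> \<theta>0 i < \<theta>0 j"
        by (auto simp: sgn_if split: if_splits)
    qed
    \<comment> \<open>The generating merits show that the identified set is nonempty.\<close>
    moreover have "\<theta>0 \<in> equivalent_merits q G link_functions P"
      using F0 \<theta>0 unfolding P by (auto simp: equivalent_merits_iff[OF F0])
    ultimately have "identified_set q G link_functions P = {ranking q \<theta>0}"
      unfolding identified_set_def by blast
    then show "is_singleton (identified_set q G link_functions P)" by simp
  qed
next
  assume id: ?id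
  show ?near
  proof (intro ballI impI, rule ccontr)
    fix u v assume uv: "u \<in> {1..q}" "v \<in> {1..q}" "u \<noteq> v"
      and "\<not> ((u, v) \<in> parcs G \<or> (\<exists>w. (u, w) \<in> parcs G \<and> (v, w) \<in> parcs G))"
    then have non: "(u, v) \<notin> parcs G" "(v, u) \<notin> parcs G"
      and disj: "\<And>w. (u, w) \<in> parcs G \<Longrightarrow> (v, w) \<notin> parcs G"
      using tournament_arcs(1) by blast+
    \<comment> \<open>Any link function will do: the counterexample lies in the merits and uses only
      the monotonicity of \<open>F0\<close>.\<close>
    obtain F0 where F0: "F0 \<in> link_functions" using link_functions_nonempty by blast
    \<comment> \<open>\<open>\<theta> 0\<close> ties \<open>u\<close> and \<open>v\<close>. The
      value 1/2 lies strictly between 0 and 1, so moving \<open>v\<close> there breaks ties at merit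
      0 and reverses no strict comparison.\<close>
    define \<theta> :: "real \<Rightarrow> nat \<Rightarrow> real" where "\<theta> c = (\<lambda>l\<in>{1..q}.
      if l = u then 0 else if l = v then c else if (u, l) \<in> parcs G then 2 else 1)" for c
    have merit: "\<theta> c \<in> merit_vectors q" for c by (simp add: \<theta>_def merit_vectors_def)
    define P where "P = tournament_law G F0 (\<theta> 0)"
    have mono: "\<theta> 0 i \<le> \<theta> 0 j" if "\<theta> (1/2) i \<le> \<theta> (1/2) j" "i \<in> {1..q}" "j \<in> {1..q}" for i j
      using that by (auto simp: \<theta>_def split: if_splits)
    \<comment> \<open>The only strict inequality lost on returning to \<open>\<theta> 0\<close> is
      that of \<open>u\<close> against \<open>v\<close>.\<close>
    have strict: "\<theta> 0 i < \<theta> 0 j \<or> i = u \<and> j = v"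
      if "\<theta> (1/2) i < \<theta> (1/2) j" "i \<in> {1..q}" "j \<in> {1..q}" for i j
      using that by (auto simp: \<theta>_def split: if_splits)
    \<comment> \<open>Non-adjacency keeps \<open>u\<close> and \<open>v\<close> out of both
      neighbourhoods; the absence of a common neighbour then separates the levels 2 and 1.\<close>
    have nbr_u: "\<theta> 0 k = 2" if "(u, k) \<in> parcs G" for k
      using that tournament_arcs[OF that] non by (auto simp: \<theta>_def)
    have nbr_v: "\<theta> 0 k = 1" if "(v, k) \<in> parcs G" for k
      using that tournament_arcs[OF that] non disj by (auto simp: \<theta>_def)
    have "\<theta> (1/2) \<in> equivalent_merits q G link_functions P" unfolding P_def
    proof (rule equivalent_meritsI[OF F0 merit])
      fix i k j l
      assume *: "(i, k) \<in> parcs G" "(j, l) \<in> parcs G"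
        "\<theta> (1/2) j \<le> \<theta> (1/2) i" "\<theta> (1/2) k \<le> \<theta> (1/2) l"
      note arcs = tournament_arcs[OF *(1)] tournament_arcs[OF *(2)]
      have le: "\<theta> 0 j \<le> \<theta> 0 i" "\<theta> 0 k \<le> \<theta> 0 l"
        using mono * arcs by blast+
      have "\<theta> 0 j < \<theta> 0 i \<or> \<theta> 0 k < \<theta> 0 l"
        if "\<theta> (1/2) i \<noteq> \<theta> (1/2) j \<or> \<theta> (1/2) k \<noteq> \<theta> (1/2) l"
      proof -
        have "\<theta> (1/2) j < \<theta> (1/2) i \<or> \<theta> (1/2) k < \<theta> (1/2) l" using that *(3,4) by linarith
        \<comment> \<open>When one coordinate only compares \<open>u\<close> with \<open>v\<close>,
          the other one compares a neighbour of \<open>u\<close> with a neighbour of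
          \<open>v\<close>, and the gap between 2 and 1 supplies the strictness.\<close>
        then consider "\<theta> 0 j < \<theta> 0 i \<or> \<theta> 0 k < \<theta> 0 l" | "j = u" "i = v" | "k = u" "l = v"
          using strict arcs by blast
        then show ?thesis
        proof cases
          case 2
          then show ?thesis using nbr_u[of l] nbr_v[of k] *(1,2) by simp
        next
          case 3
          then show ?thesis using nbr_u[of i] nbr_v[of j] arcs by simp
        qed
      qed
      then show "F0 (\<theta> 0 i) (\<theta> 0 k) \<le> F0 (\<theta> 0 j) (\<theta> 0 l) \<and>
          (\<theta> (1/2) i \<noteq> \<theta> (1/2) j \<or> \<theta> (1/2) k \<noteq> \<theta> (1/2) l \<longrightarrow>
            F0 (\<theta> 0 i) (\<theta> 0 k) < F0 (\<theta> 0 j) (\<theta> 0 l))"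
        using link_function_le[OF F0 le] link_function_less[OF F0 le] by blast
    qed
    moreover have "\<theta> 0 \<in> equivalent_merits q G link_functions P"
      using F0 merit unfolding P_def by (auto simp: equivalent_merits_iff[OF F0])
    moreover have "is_singleton (identified_set q G link_functions P)"
      using id F0 merit unfolding point_identified_def permissible_def P_def by blast
    ultimately have "ranking q (\<theta> (1/2)) = ranking q (\<theta> 0)"
      unfolding identified_set_def by (metis imageI is_singletonE singletonD)
    moreover have "\<theta> (1/2) u < \<theta> (1/2) v" "\<not> \<theta> 0 u < \<theta> 0 v"
      using uv by (simp_all add: \<theta>_def)
    ultimately show False
      using ranking_less_iff[OF uv(1,2), of "\<theta> (1/2)"] ranking_less_iff[OF uv(1,2), of "\<theta> 0"] by simp
  qed
qed

end

section \<open>From link values and common opponents to expectations and paths\<close>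

theorem theorem2:
  fixes q :: nat and G :: "nat pair_pre_digraph" and P :: "outcome pmf"
    and F\<^sub>0 :: "real \<Rightarrow> real \<Rightarrow> real" and \<theta>\<^sub>0 :: "nat \<Rightarrow> real" and r :: "nat \<Rightarrow> nat"
  assumes "tournament_graph q G"
    and "F\<^sub>0 \<in> link_functions" and "\<theta>\<^sub>0 \<in> merit_vectors q"
    and "P = tournament_law G F\<^sub>0 \<theta>\<^sub>0"
    and "r \<in> possible_rankings q"
  shows "(r \<in> identified_set q G link_functions P \<longleftrightarrow>
           (\<forall>(l, k) \<in> parcs G.
              sgn (measure_pmf.expectation P (\<lambda>\<omega>. wins l k \<omega> - 1/2)) = sgn (real (r k) - real (r l)))
         \<and> (\<forall>(i, k) \<in> parcs G. \<forall>(j, l) \<in> parcs G. r i = r j \<longrightarrow>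
              sgn (measure_pmf.expectation P (\<lambda>\<omega>. wins i k \<omega> - wins j l \<omega>)) = sgn (real (r k) - real (r l)))
         \<and> (\<forall>(i, k) \<in> parcs G. \<forall>(j, l) \<in> parcs G. r i > r j \<longrightarrow>
              (r l \<ge> r k \<longrightarrow>
                 measure_pmf.expectation P (wins i k) < measure_pmf.expectation P (wins j l))))
       \<and> (point_identified q G link_functions \<longleftrightarrow>
           (\<forall>u \<in> {1..q}. \<forall>v \<in> {1..q}. u \<noteq> v \<longrightarrow>
              (\<exists>p. pre_digraph.apath (with_proj G) u p v \<and> length p \<le> 2)))"
proof -
  note G = assms(1)
  define p where "p l k = F\<^sub>0 (\<theta>\<^sub>0 l) (\<theta>\<^sub>0 k)" for l k
  have E: "measure_pmf.expectation P (wins l k) = p l k" if "(l, k) \<in> parcs G" for l k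
    using prob_wins_tournament_law[OF G assms(2) that] by (simp add: expectation_wins assms(4) p_def)
  have E1: "measure_pmf.expectation P (\<lambda>\<omega>. wins l k \<omega> - 1/2) = p l k - 1/2"
    if "(l, k) \<in> parcs G" for l k
    using E[OF that] by (subst Bochner_Integration.integral_diff) (auto intro: integrable_wins)
  have E2: "measure_pmf.expectation P (\<lambda>\<omega>. wins i k \<omega> - wins j l \<omega>) = p i k - p j l"
    if "(i, k) \<in> parcs G" "(j, l) \<in> parcs G" for i k j l
    using E[OF that(1)] E[OF that(2)]
    by (subst Bochner_Integration.integral_diff) (auto intro: integrable_wins)
  show ?thesis
    unfolding point_identified_iff[OF G] assms(4) identified_set_iff[OF G assms(2,5)]
    unfolding assms(4)[symmetric] p_def[symmetric]
    \<comment> \<open>The congruence rules supply arc membership and \<open>u \<noteq> v\<close> as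
      premises of the conditional rewrite rules under the quantifiers.\<close>
    by (simp only: simp_thms Ball_def split_paired_All prod.case E E1 E2 apath_length_le_two_iff[OF G]
        cong: imp_cong conj_cong)
qed

end
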